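(* Let $n\ge 5$ and let $f:\mathcal{D}(S^{B_n})\to Q$ be a surjective quandle homomorphism onto a quandle $Q$ with at least two elements, where $B_n$ is the braid group on $n$ strands and $S$ its standard generating set. Then $|Q|\ge \frac{n(n-1)}{2}$, and the bound is sharp (i.e., for each $n \ge 5$ it is attained by some such $f$ and $Q$).
   Context: $B_n=\langle \sigma_1,\ldots,\sigma_{n-1}\mid \sigma_i\sigma_{i+1}\sigma_i=\sigma_{i+1}\sigma_i\sigma_{i+1},\ \sigma_i\sigma_j=\sigma_j\sigma_i \text{ for } |i-j|\ge 2\rangle$ and $S=\{\sigma_1,\ldots,\sigma_{n-1}\}$. A quandle is a non-empty set $Q$ with a binary operation $*$ such that: $x*x=x$ for all $x$; for all $x,y$ there is a unique $z$ with $x=z*y$; and $(x*y)*z=(x*z)*(y*z)$ for all $x,y,z$. For a group $G$ and a non-empty subset $A\subseteq G$, the Dehn quandle $\mathcal{D}(A^G)$ is the set $A^G$ of all conjugates in $G$ of elements of $A$, with operation $x*y=yxy^{-1}$. *)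

theory Defs
  imports "HOL-Algebra.Group"
begin

section \<open>Groups given by generators and relations\<close>

text \<open>
  A letter \<^term>\<open>(True, x)\<close> stands for the generator \<^term>\<open>x\<close> and \<^term>\<open>(False, x)\<close> for its
  formal inverse. The group presented by generators \<^term>\<open>X\<close> and relations \<^term>\<open>R\<close> (a pair
  \<^term>\<open>(u, v)\<close> in \<^term>\<open>R\<close> being the relation \<open>u = v\<close>) consists of the words over \<^term>\<open>X\<close> modulo
  the least congruence that contains \<^term>\<open>R\<close> and makes opposite letters cancel.
\<close>

type_synonym 'a gword = "(bool \<times> 'a) list"

definition gwords :: "'a set \<Rightarrow> 'a gword set" where
  "gwords X = lists (UNIV \<times> X)"

inductive_set pres_cong :: "'a set \<Rightarrow> ('a gword \<times> 'a gword) set \<Rightarrow> ('a gword \<times> 'a gword) set"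
  for X :: "'a set" and R :: "('a gword \<times> 'a gword) set" where
  rel: "\<lbrakk>(u, v) \<in> R; u \<in> gwords X; v \<in> gwords X\<rbrakk> \<Longrightarrow> (u, v) \<in> pres_cong X R"
| cancel: "x \<in> X \<Longrightarrow> ([(b, x), (\<not> b, x)], []) \<in> pres_cong X R"
| refl: "u \<in> gwords X \<Longrightarrow> (u, u) \<in> pres_cong X R"
| sym: "(u, v) \<in> pres_cong X R \<Longrightarrow> (v, u) \<in> pres_cong X R"
| trans: "\<lbrakk>(u, v) \<in> pres_cong X R; (v, w) \<in> pres_cong X R\<rbrakk> \<Longrightarrow> (u, w) \<in> pres_cong X R"
| append: "\<lbrakk>(u, v) \<in> pres_cong X R; (u', v') \<in> pres_cong X R\<rbrakk> \<Longrightarrow> (u @ u', v @ v') \<in> pres_cong X R"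

definition pres_class ::
    "'a set \<Rightarrow> ('a gword \<times> 'a gword) set \<Rightarrow> 'a gword \<Rightarrow> 'a gword set" where
  "pres_class X R w = pres_cong X R `` {w}"

definition presented_group ::
    "'a set \<Rightarrow> ('a gword \<times> 'a gword) set \<Rightarrow> 'a gword set monoid" where
  "presented_group X R =
    \<lparr>carrier = gwords X // pres_cong X R,
     monoid.mult = (\<lambda>A B. \<Union>u\<in>A. \<Union>v\<in>B. pres_class X R (u @ v)),
     one = pres_class X R []\<rparr>"

lemma pres_cong_gwords:
  "(u, v) \<in> pres_cong X R \<Longrightarrow> u \<in> gwords X \<and> v \<in> gwords X"
  by (induction rule: pres_cong.induct) (auto simp: gwords_def)

lemma equiv_pres_cong: "equiv (gwords X) (pres_cong X R)"
proof (rule equivI)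
  show "pres_cong X R \<subseteq> gwords X \<times> gwords X" by (auto dest: pres_cong_gwords)
  show "refl_on (gwords X) (pres_cong X R)" by (rule refl_onI) (rule pres_cong.refl)
  show "sym (pres_cong X R)" by (rule symI) (rule pres_cong.sym)
  show "trans (pres_cong X R)" by (rule transI) (rule pres_cong.trans)
qed

lemma carrier_presented_group:
  "carrier (presented_group X R) = pres_class X R ` gwords X"
  by (auto simp: presented_group_def quotient_def pres_class_def)

lemma pres_class_eq_iff:
  assumes "u \<in> gwords X" "v \<in> gwords X"
  shows "pres_class X R u = pres_class X R v \<longleftrightarrow> (u, v) \<in> pres_cong X R"
  using assms eq_equiv_class_iff[OF equiv_pres_cong] by (simp add: pres_class_def)

lemma mult_pres_class:
  assumes "u \<in> gwords X" "v \<in> gwords X"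
  shows "pres_class X R u \<otimes>\<^bsub>presented_group X R\<^esub> pres_class X R v = pres_class X R (u @ v)"
proof -
  define K where "K = pres_class X R (u @ v)"
  have K: "pres_class X R (u' @ v') = K"
    if "u' \<in> pres_class X R u" "v' \<in> pres_class X R v" for u' v'
    using that equiv_class_eq[OF equiv_pres_cong pres_cong.append, of u u' X R v v']
    by (simp add: pres_class_def K_def)
  have "(\<Union>u'\<in>pres_class X R u. \<Union>v'\<in>pres_class X R v. pres_class X R (u' @ v')) =
      (\<Union>u'\<in>pres_class X R u. \<Union>v'\<in>pres_class X R v. K)"
    by (intro SUP_cong HOL.refl K)
  moreover have "u \<in> pres_class X R u" "v \<in> pres_class X R v"
    using assms by (auto simp: pres_class_def intro: pres_cong.refl)
  ultimately show ?thesis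
    by (auto simp: presented_group_def K_def)
qed

lemma pres_cong_left_inverse:
  assumes "w \<in> gwords X"
  shows "(map (apfst Not) (rev w) @ w, []) \<in> pres_cong X R"
  using assms
proof (induction w)
  case Nil
  then show ?case by (simp add: pres_cong.refl)
next
  case (Cons a w)
  obtain b x where a: "a = (b, x)" by (cases a)
  define w' where "w' = map (apfst Not) (rev w)"
  have w: "w \<in> gwords X" and x: "x \<in> X" using Cons.prems a by (auto simp: gwords_def)
  then have w': "w' \<in> gwords X" by (fastforce simp: w'_def gwords_def)
  have "([(\<not> b, x), (b, x)], []) \<in> pres_cong X R"
    using pres_cong.cancel[OF x, of "\<not> b"] by simp
  then have "(w' @ ([(\<not> b, x), (b, x)] @ w), w' @ ([] @ w)) \<in> pres_cong X R"
    using w w' by (intro pres_cong.append pres_cong.refl)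
  moreover have "(w' @ w, []) \<in> pres_cong X R" using Cons.IH w by (simp add: w'_def)
  ultimately have "(w' @ ([(\<not> b, x), (b, x)] @ w), []) \<in> pres_cong X R"
    using pres_cong.trans by fastforce
  then show ?case by (simp add: a w'_def)
qed

lemma group_presented_group: "group (presented_group X R)"
proof (rule groupI)
  let ?G = "presented_group X R"
  have app: "u @ v \<in> gwords X" if "u \<in> gwords X" "v \<in> gwords X" for u v
    using that by (auto simp: gwords_def)
  have nil: "[] \<in> gwords X" by (simp add: gwords_def)
  have one: "\<one>\<^bsub>?G\<^esub> = pres_class X R []" by (simp add: presented_group_def)
  show "\<one>\<^bsub>?G\<^esub> \<in> carrier ?G" using nil by (simp add: one carrier_presented_group)
  fix A assume "A \<in> carrier ?G"
  then obtain u where u: "u \<in> gwords X" "A = pres_class X R u"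
    by (auto simp: carrier_presented_group)
  show "\<one>\<^bsub>?G\<^esub> \<otimes>\<^bsub>?G\<^esub> A = A" using nil u by (simp add: one mult_pres_class)
  define u' where "u' = map (apfst Not) (rev u)"
  have u': "u' \<in> gwords X" using u(1) by (fastforce simp: u'_def gwords_def)
  have "pres_class X R u' \<otimes>\<^bsub>?G\<^esub> A = \<one>\<^bsub>?G\<^esub>"
    using u u' nil pres_cong_left_inverse[OF u(1), of R]
    by (simp add: one mult_pres_class pres_class_eq_iff app flip: u'_def)
  then show "\<exists>B\<in>carrier ?G. B \<otimes>\<^bsub>?G\<^esub> A = \<one>\<^bsub>?G\<^esub>"
    using u' by (auto simp: carrier_presented_group)
  fix B assume "B \<in> carrier ?G"
  then obtain v where v: "v \<in> gwords X" "B = pres_class X R v"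
    by (auto simp: carrier_presented_group)
  show "A \<otimes>\<^bsub>?G\<^esub> B \<in> carrier ?G"
    using u v app by (simp add: mult_pres_class carrier_presented_group)
  fix C assume "C \<in> carrier ?G"
  then obtain w where w: "w \<in> gwords X" "C = pres_class X R w"
    by (auto simp: carrier_presented_group)
  show "A \<otimes>\<^bsub>?G\<^esub> B \<otimes>\<^bsub>?G\<^esub> C = A \<otimes>\<^bsub>?G\<^esub> (B \<otimes>\<^bsub>?G\<^esub> C)"
    using u v w app by (simp add: mult_pres_class)
qed

section \<open>Braid groups\<close>

definition braid_relations :: "nat \<Rightarrow> (nat gword \<times> nat gword) set" where
  "braid_relations n =
    {([(True, i), (True, i + 1), (True, i)], [(True, i + 1), (True, i), (True, i + 1)]) | i.
        1 \<le> i \<and> i + 1 < n} \<union>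
    {([(True, i), (True, j)], [(True, j), (True, i)]) | i j.
        i \<in> {1..<n} \<and> j \<in> {1..<n} \<and> 2 \<le> \<bar>int i - int j\<bar>}"

definition braid_group :: "nat \<Rightarrow> nat gword set monoid" where
  "braid_group n = presented_group {1..<n} (braid_relations n)"

definition braid_gen :: "nat \<Rightarrow> nat \<Rightarrow> nat gword set" where
  "braid_gen n i = pres_class {1..<n} (braid_relations n) [(True, i)]"

definition braid_gens :: "nat \<Rightarrow> nat gword set set" where
  "braid_gens n = braid_gen n ` {1..<n}"

lemma group_braid_group: "group (braid_group n)"
  by (simp add: braid_group_def group_presented_group)

lemma braid_gens_subset: "braid_gens n \<subseteq> carrier (braid_group n)"
  by (auto simp: braid_gens_def braid_gen_def braid_group_def carrier_presented_group gwords_def)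

section \<open>Quandles\<close>

record 'a quandle_struct = "'a partial_object" +
  qop :: "'a \<Rightarrow> 'a \<Rightarrow> 'a"  (infixl "\<star>\<index>" 70)

locale quandle =
  fixes Q :: "('a, 'm) quandle_struct_scheme" (structure)
  assumes nonempty: "carrier Q \<noteq> {}"
    and closed: "\<lbrakk>x \<in> carrier Q; y \<in> carrier Q\<rbrakk> \<Longrightarrow> x \<star> y \<in> carrier Q"
    and idem: "x \<in> carrier Q \<Longrightarrow> x \<star> x = x"
    and ex1_left: "\<lbrakk>x \<in> carrier Q; y \<in> carrier Q\<rbrakk> \<Longrightarrow> \<exists>!z. z \<in> carrier Q \<and> x = z \<star> y"
    and distrib: "\<lbrakk>x \<in> carrier Q; y \<in> carrier Q; z \<in> carrier Q\<rbrakk>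
      \<Longrightarrow> (x \<star> y) \<star> z = (x \<star> z) \<star> (y \<star> z)"

definition quandle_hom ::
    "('a, 'm) quandle_struct_scheme \<Rightarrow> ('b, 'k) quandle_struct_scheme \<Rightarrow> ('a \<Rightarrow> 'b) set" where
  "quandle_hom P Q =
    {f. f \<in> carrier P \<rightarrow> carrier Q \<and>
        (\<forall>x\<in>carrier P. \<forall>y\<in>carrier P. f (x \<star>\<^bsub>P\<^esub> y) = f x \<star>\<^bsub>Q\<^esub> f y)}"

definition quandle_epi ::
    "('a, 'm) quandle_struct_scheme \<Rightarrow> ('b, 'k) quandle_struct_scheme \<Rightarrow> ('a \<Rightarrow> 'b) set" where
  "quandle_epi P Q = {f \<in> quandle_hom P Q. f ` carrier P = carrier Q}"

definition dehn_quandle :: "('a, 'm) monoid_scheme \<Rightarrow> 'a set \<Rightarrow> 'a quandle_struct" where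
  "dehn_quandle G A =
    \<lparr>carrier = {g \<otimes>\<^bsub>G\<^esub> a \<otimes>\<^bsub>G\<^esub> inv\<^bsub>G\<^esub> g | g a. g \<in> carrier G \<and> a \<in> A},
     qop = (\<lambda>x y. y \<otimes>\<^bsub>G\<^esub> x \<otimes>\<^bsub>G\<^esub> inv\<^bsub>G\<^esub> y)\<rparr>"

lemma (in group) quandle_dehn_quandle:
  assumes "A \<subseteq> carrier G" "A \<noteq> {}"
  shows "quandle (dehn_quandle G A)"
proof -
  let ?D = "dehn_quandle G A"
  have car: "x \<in> carrier G" if "x \<in> carrier ?D" for x
    using that assms(1) by (auto simp: dehn_quandle_def)
  have conj: "h \<otimes> x \<otimes> inv h \<in> carrier ?D" if x: "x \<in> carrier ?D" and h: "h \<in> carrier G" for h x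
  proof -
    obtain g a where ga: "g \<in> carrier G" "a \<in> A" "x = g \<otimes> a \<otimes> inv g"
      using x by (auto simp: dehn_quandle_def)
    have "h \<otimes> x \<otimes> inv h = (h \<otimes> g) \<otimes> a \<otimes> inv (h \<otimes> g)"
      using ga h assms(1) by (auto simp: m_assoc inv_mult_group subset_eq)
    then show ?thesis using ga h by (auto simp: dehn_quandle_def)
  qed
  have cancel: "inv u \<otimes> (u \<otimes> v) = v" "u \<otimes> (inv u \<otimes> v) = v"
    if "u \<in> carrier G" "v \<in> carrier G" for u v
    using that by (simp_all flip: m_assoc)
  have op: "x \<star>\<^bsub>?D\<^esub> y = y \<otimes> x \<otimes> inv y" for x y by (simp add: dehn_quandle_def)
  show ?thesis
  proof
    show "carrier ?D \<noteq> {}" using assms(2) by (auto simp: dehn_quandle_def)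
  next
    fix x y assume "x \<in> carrier ?D" "y \<in> carrier ?D"
    then show "x \<star>\<^bsub>?D\<^esub> y \<in> carrier ?D" by (simp add: op conj car)
  next
    fix x assume "x \<in> carrier ?D"
    then show "x \<star>\<^bsub>?D\<^esub> x = x" by (simp add: op car m_assoc)
  next
    fix x y assume xy: "x \<in> carrier ?D" "y \<in> carrier ?D"
    show "\<exists>!z. z \<in> carrier ?D \<and> x = z \<star>\<^bsub>?D\<^esub> y"
    proof (rule ex1I[of _ "inv y \<otimes> x \<otimes> y"], intro conjI)
      show "inv y \<otimes> x \<otimes> y \<in> carrier ?D"
        using conj[OF xy(1), of "inv y"] xy car by simp
      show "x = (inv y \<otimes> x \<otimes> y) \<star>\<^bsub>?D\<^esub> y"
        using xy car by (simp add: op m_assoc cancel)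
    next
      fix z assume "z \<in> carrier ?D \<and> x = z \<star>\<^bsub>?D\<^esub> y"
      then show "z = inv y \<otimes> x \<otimes> y"
        using xy car by (simp add: op m_assoc cancel)
    qed
  next
    fix x y z assume "x \<in> carrier ?D" "y \<in> carrier ?D" "z \<in> carrier ?D"
    then show "(x \<star>\<^bsub>?D\<^esub> y) \<star>\<^bsub>?D\<^esub> z = (x \<star>\<^bsub>?D\<^esub> z) \<star>\<^bsub>?D\<^esub> (y \<star>\<^bsub>?D\<^esub> z)"
      by (simp add: op m_assoc inv_mult_group cancel car)
  qed
qed

end

theory Submission
  imports Defs "HOL-Algebra.Sym_Groups"
begin

text \<open>
  A homomorphism \<open>f\<close> from the Dehn quandle of the braid group to a quandle \<open>Q\<close> carries the Artin
  generators to elements \<open>q\<^sub>1, \<dots>, q\<^sub>n\<^sub>-\<^sub>1\<close> of \<open>Q\<close> on which the braid relations hold in quandle form: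
  \<open>q\<^sub>i \<star> q\<^sub>j = q\<^sub>i\<close> for \<open>\<bar>i - j\<bar> \<ge> 2\<close> and \<open>(q\<^sub>i \<star> q\<^sub>j) \<star> q\<^sub>i = q\<^sub>j\<close> for \<open>\<bar>i - j\<bar> = 1\<close>. The lower
  bound is a statement about such elements that are not all equal. This last condition holds because
  the generators generate the braid group: if \<open>f\<close> is constant on them, then it is constant, and the
  surjectivity of \<open>f\<close> makes \<open>Q\<close> a point (\<open>quandle_hom_const_if_const_on_generators\<close>).

  For \<open>1 \<le> i < j \<le> n\<close> let \<open>a\<^sub>i\<^sub>j = q\<^sub>i \<star> q\<^sub>i\<^sub>+\<^sub>1 \<star> \<dots> \<star> q\<^sub>j\<^sub>-\<^sub>1\<close> (bracketed to the left). It is the image of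
  a band generator of the braid group, the half twist of the strands \<open>i\<close> and \<open>j\<close>. The point is to
  recover the pair from the element: \<open>\<star> q\<^sub>m\<close> moves \<open>a\<^sub>i\<^sub>j\<close> exactly when one, and only one, of \<open>m\<close> and
  \<open>m + 1\<close> belongs to \<open>{i, j}\<close> (\<open>band_moved_iff\<close>). Thus \<open>a\<^sub>i\<^sub>j\<close> determines the set of edges of the path
  \<open>1, 2, \<dots>, n\<close> that are cut by \<open>{i, j}\<close>, and a subset of the vertices of a path is determined by
  its cut up to complement. The complement of a pair has \<open>n - 2\<close> elements, so for \<open>n \<ge> 5\<close> it is not
  a pair, and the \<open>n(n - 1)/2\<close> elements \<open>a\<^sub>i\<^sub>j\<close> are distinct (\<open>band_pair_unique\<close>). For \<open>n = 4\<close> the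
  argument breaks down at \<open>{1, 2}\<close> and \<open>{3, 4}\<close>, and so does the bound: the map onto the symmetric
  group of degree 3 identifies \<open>\<sigma>\<^sub>1\<close> with \<open>\<sigma>\<^sub>3\<close>.

  The bound is attained by the permutation map to the symmetric group. The image of the Dehn
  quandle consists of transpositions, so it has at most \<open>n(n - 1)/2\<close> elements; it has at least two,
  so by the lower bound it has exactly that many.
\<close>

section \<open>Quandles with elements satisfying the braid relations\<close>

lemma two_subset_Min_Max:
  fixes B :: "nat set"
  assumes "card B = 2"
  shows "B = {Min B, Max B}" "Min B < Max B"
proof -
  obtain x y where "B = {x, y}" "x \<noteq> y" using assms by (auto simp: card_2_iff)
  then obtain i j where "B = {i, j}" "i < j" by (metis insert_commute linorder_neqE_nat)
  then show "B = {Min B, Max B}" "Min B < Max B" by simp_all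
qed

locale braided_quandle = quandle Q for Q :: "('a, 'm) quandle_struct_scheme" (structure) +
  fixes n :: nat and q :: "nat \<Rightarrow> 'a"
  assumes q_closed: "i \<in> {1..<n} \<Longrightarrow> q i \<in> carrier Q"
    and q_far: "\<lbrakk>i \<in> {1..<n}; j \<in> {1..<n}; i + 1 < j \<or> j + 1 < i\<rbrakk> \<Longrightarrow> q i \<star> q j = q i"
    and q_adjacent: "\<lbrakk>i \<in> {1..<n}; j \<in> {1..<n}; j = i + 1 \<or> i = j + 1\<rbrakk>
      \<Longrightarrow> (q i \<star> q j) \<star> q i = q j"
begin

lemma star_right_cancel:
  assumes "x \<in> carrier Q" "y \<in> carrier Q" "z \<in> carrier Q" "x \<star> z = y \<star> z"
  shows "x = y"
  using ex1_left[of "x \<star> z" z] assms closed by metis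

text \<open>
  The right translations by \<open>q i\<close> satisfy the braid relation, because right translations are
  automorphisms and \<open>q (i + 1)\<close> is moved to \<open>q i\<close> by \<open>q i\<close> followed by \<open>q (i + 1)\<close>.
\<close>

lemma star_braid:
  assumes x: "x \<in> carrier Q" and i: "i \<in> {1..<n}" "i + 1 \<in> {1..<n}"
  shows "((x \<star> q i) \<star> q (i + 1)) \<star> q i = ((x \<star> q (i + 1)) \<star> q i) \<star> q (i + 1)"
proof -
  note cl = x q_closed[OF i(1)] q_closed[OF i(2)]
  have "(x \<star> q (i + 1)) \<star> q i = (x \<star> q i) \<star> (q (i + 1) \<star> q i)"
    by (rule distrib[OF cl(1,3,2)])
  then have "((x \<star> q (i + 1)) \<star> q i) \<star> q (i + 1) = ((x \<star> q i) \<star> (q (i + 1) \<star> q i)) \<star> q (i + 1)"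
    by simp
  also have "\<dots> = ((x \<star> q i) \<star> q (i + 1)) \<star> ((q (i + 1) \<star> q i) \<star> q (i + 1))"
    using cl by (intro distrib closed)
  also have "\<dots> = ((x \<star> q i) \<star> q (i + 1)) \<star> q i"
    using q_adjacent[of "i + 1" i] i by simp
  finally show ?thesis by simp
qed

text \<open>
  The image of the band generator of the strands \<open>i < j\<close>. The value \<open>q i\<close> for \<open>j \<le> i + 1\<close> makes the
  recursion on \<open>j\<close> start with \<open>band i (i + 1) = q i\<close>; only the arguments \<open>i < j\<close> have a meaning.
\<close>

primrec band :: "nat \<Rightarrow> nat \<Rightarrow> 'a" where
  "band i 0 = q i"
| "band i (Suc j) = (if i < j then band i j \<star> q j else q i)"

lemma band_Suc: "i < j \<Longrightarrow> band i (j + 1) = band i j \<star> q j"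
  and band_adjacent: "band i (i + 1) = q i"
  by simp_all

lemma band_closed: "\<lbrakk>1 \<le> i; i < j; j \<le> n\<rbrakk> \<Longrightarrow> band i j \<in> carrier Q"
  by (induction j) (auto simp: q_closed closed)

lemma band_fixed_outside:
  assumes "1 \<le> i" "i < j" "j \<le> n" "k \<in> {1..<n}" "k + 1 < i \<or> j < k"
  shows "band i j \<star> q k = band i j"
proof -
  have "i + 1 \<le> j" using assms by simp
  then show ?thesis using assms(3,5)
  proof (induction j rule: dec_induct)
    case base
    then show ?case using assms(1,4) by (auto simp: q_far)
  next
    case (step j)
    have "band i j \<star> q k = band i j" "q j \<star> q k = q j"
      using step assms(1,4) by (auto simp: q_far)
    then show ?case
      using step assms(1,4) distrib[of "band i j" "q j" "q k"] by (simp add: band_closed q_closed)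
  qed
qed

text \<open>
  For \<open>i < k\<close> and \<open>j = k + 2\<close> the relation \<open>star_braid\<close> turns \<open>q k\<close> after \<open>q k, q (k + 1)\<close> into
  \<open>q (k + 1)\<close> before them, and that acts trivially on \<open>band i k\<close>, which ends at strand \<open>k\<close>.
\<close>

lemma band_fixed_inside:
  assumes "1 \<le> i" "i < k" "k + 1 < j" "j \<le> n"
  shows "band i j \<star> q k = band i j"
proof -
  have "k + 2 \<le> j" using assms by simp
  then show ?thesis using assms(4)
  proof (induction j rule: dec_induct)
    case base
    have "band i k \<star> q (k + 1) = band i k"
      using base assms by (intro band_fixed_outside) auto
    then show ?case
      using base assms star_braid[of "band i k" k] by (simp add: band_closed)
  next
    case (step j)
    have "q j \<star> q k = q j"
      using step assms by (auto simp: q_far)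
    then show ?case
      using step assms distrib[of "band i j" "q j" "q k"] by (simp add: band_closed q_closed)
  qed
qed

lemma band_shift_left:
  assumes "1 \<le> i" "i + 1 < j" "j \<le> n"
  shows "band i j \<star> q i = band (i + 1) j"
proof -
  have "i + 2 \<le> j" using assms by simp
  then show ?thesis using assms(3)
  proof (induction j rule: dec_induct)
    case base
    then show ?case using assms q_adjacent[of i "i + 1"] by simp
  next
    case (step j)
    have "q j \<star> q i = q j"
      using step assms by (auto simp: q_far)
    then show ?case
      using step assms distrib[of "band i j" "q j" "q i"] by (simp add: band_closed q_closed)
  qed
qed

lemma generators_eq_if_fixed:
  assumes "i \<in> {1..<n}" "j \<in> {1..<n}" "j = i + 1 \<or> i = j + 1" "q i \<star> q j = q i"
  shows "q i = q j"
  using q_adjacent[OF assms(1,2,3)] assms(4) idem[OF q_closed[OF assms(1)]] by metis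

text \<open>
  Equality of two neighbours spreads along the whole chain: if \<open>q j = q (j + 1)\<close>, then
  \<open>q (j + 1)\<close> is fixed by \<open>q (j + 2)\<close>, as \<open>q j\<close> is, and so the two are equal by
  \<open>generators_eq_if_fixed\<close>; in the same way downwards.
\<close>

lemma generators_all_eq:
  assumes i: "1 \<le> i" "i + 1 < n" and eq: "q i = q (i + 1)"
  shows "j \<in> {1..<n} \<Longrightarrow> q j = q i"
proof -
  have up: "q (Suc j) = q j" if "i \<le> j" "j + 1 < n" for j
    using that
  proof (induction j rule: dec_induct)
    case base
    then show ?case using eq by simp
  next
    case (step j)
    have "q j \<star> q (j + 2) = q j"
      using step.hyps step.prems i by (intro q_far) auto
    moreover have "q (Suc j) = q j" using step by simp
    ultimately have "q (Suc j) \<star> q (j + 2) = q (Suc j)" by simp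
    then show ?case
      using generators_eq_if_fixed[of "Suc j" "j + 2"] step.hyps step.prems i by simp
  qed
  have down: "q (Suc j) = q j" if "j \<le> i" "1 \<le> j" for j
    using that
  proof (induction j rule: inc_induct)
    case base
    then show ?case using eq by simp
  next
    case (step j)
    have "q (j + 2) \<star> q j = q (j + 2)"
      using step.hyps step.prems i by (intro q_far) auto
    moreover have "q (j + 2) = q (Suc j)" using step by simp
    ultimately have "q (Suc j) \<star> q j = q (Suc j)" by simp
    then show ?case
      using generators_eq_if_fixed[of "Suc j" j] step.hyps step.prems i by simp
  qed
  have above: "q j = q i" if "i \<le> j" "j < n" for j
    using that by (induction j rule: dec_induct) (auto simp: up)
  have below: "q j = q i" if "j \<le> i" "1 \<le> j" for j
    using that by (induction j rule: inc_induct) (auto simp flip: down)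
  show "j \<in> {1..<n} \<Longrightarrow> q j = q i"
    using above[of j] below[of j] by (cases "i \<le> j") auto
qed

end

locale nonconstant_braided_quandle = braided_quandle +
  assumes nonconst: "\<exists>i\<in>{1..<n}. \<exists>j\<in>{1..<n}. q i \<noteq> q j"
begin

lemma adjacent_generators_neq:
  assumes "1 \<le> i" "i + 1 < n"
  shows "q i \<noteq> q (i + 1)"
  using generators_all_eq[OF assms] nonconst by metis

text \<open>
  The translation by \<open>q i\<close> replaces strand \<open>i\<close> by \<open>i + 1\<close> in both elements, so the claim reduces to
  \<open>i = j - 1\<close>, where it says that \<open>q (j - 1)\<close> is not fixed by \<open>q j\<close>.
\<close>

lemma band_neq_next_right:
  assumes "1 \<le> i" "i < j" "j < n"
  shows "band i j \<noteq> band i (j + 1)"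
proof -
  have "i \<le> j - 1" using assms by simp
  then show ?thesis using assms
  proof (induction i rule: inc_induct)
    case base
    then have "q (j - 1) \<noteq> q j" using adjacent_generators_neq[of "j - 1"] by simp
    moreover have "band (j - 1) j = q (j - 1)" "band (j - 1) (j + 1) = q (j - 1) \<star> q j"
      using band_adjacent[of "j - 1"] band_Suc[of "j - 1" j] base by (simp_all del: band.simps)
    ultimately show ?case
      using generators_eq_if_fixed[of "j - 1" j] base by force
  next
    case (step i)
    then have "band i j \<star> q i \<noteq> band i (j + 1) \<star> q i"
      using band_shift_left[of i j] band_shift_left[of i "j + 1"] by (simp del: band.simps)
    then show ?case by metis
  qed
qed

text \<open>
  Cancelling the last translation on both sides reduces the claim to \<open>j = i + 2\<close>, where it says
  that \<open>q i \<star> q (i + 1)\<close> differs from \<open>q (i + 1) = q (i + 1) \<star> q (i + 1)\<close>.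
\<close>

lemma band_neq_next_left:
  assumes "1 \<le> i" "i + 1 < j" "j \<le> n"
  shows "band i j \<noteq> band (i + 1) j"
proof -
  have "i + 2 \<le> j" using assms by simp
  then show ?thesis using assms(3)
  proof (induction j rule: dec_induct)
    case base
    then show ?case
      using assms adjacent_generators_neq[of i] star_right_cancel[of "q i" "q (i + 1)" "q (i + 1)"]
        idem[of "q (i + 1)"] by (auto simp: q_closed)
  next
    case (step j)
    then show ?case
      using assms star_right_cancel[of "band i j" "band (i + 1) j" "q j"]
      by (auto simp: band_closed q_closed)
  qed
qed

text \<open>
  At each end of \<open>{i, j}\<close> the translation by \<open>q m\<close>, or its inverse, slides that end between \<open>m\<close> and
  \<open>m + 1\<close>, which gives a different element by the two preceding lemmas. If \<open>{i, j} = {m, m + 1}\<close>,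
  the element is \<open>q m\<close> itself and idempotency applies; in the other cases \<open>m\<close> and \<open>m + 1\<close> are no ends.
\<close>

lemma band_moved_iff:
  assumes ij: "1 \<le> i" "i < j" "j \<le> n" and m: "m \<in> {1..<n}"
  shows "band i j \<star> q m \<noteq> band i j \<longleftrightarrow> (m \<in> {i, j}) \<noteq> (m + 1 \<in> {i, j})"
proof -
  consider (right) "m = j" | (right_inner) "m + 1 = j" "i < m" | (generator) "m = i" "j = i + 1"
    | (left_inner) "m = i" "i + 1 < j" | (left) "m + 1 = i" | (inside) "i < m" "m + 1 < j"
    | (outside) "m + 1 < i \<or> j < m"
    using ij by linarith
  then show ?thesis
  proof cases
    case right
    then show ?thesis using band_neq_next_right[of i j] band_Suc[of i j] ij m by force
  next
    case right_inner
    then have "band i j = band i m \<star> q m" "band i m \<noteq> band i j"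
      using band_Suc[of i m] band_neq_next_right[of i m] ij m by auto
    moreover have "band i j \<in> carrier Q" "band i m \<in> carrier Q"
      using right_inner ij by (auto simp: band_closed)
    ultimately have "band i j \<star> q m \<noteq> band i j"
      using star_right_cancel[of "band i j" "band i m" "q m"] q_closed[OF m] by metis
    then show ?thesis using right_inner by auto
  next
    case generator
    then show ?thesis using ij m by (simp add: idem q_closed)
  next
    case left_inner
    then show ?thesis using band_neq_next_left[of i j] band_shift_left[of i j] ij by auto
  next
    case left
    then have "band i j = band m j \<star> q m" "band m j \<noteq> band i j"
      using band_shift_left[of m j] band_neq_next_left[of m j] ij m by auto
    moreover have "band i j \<in> carrier Q" "band m j \<in> carrier Q"
      using left ij m by (auto simp: band_closed)
    ultimately have "band i j \<star> q m \<noteq> band i j"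
      using star_right_cancel[of "band i j" "band m j" "q m"] q_closed[OF m] by metis
    then show ?thesis using left ij by auto
  next
    case inside
    then show ?thesis using band_fixed_inside[of i m j] ij by auto
  next
    case outside
    then show ?thesis using band_fixed_outside[of i j m] ij m by auto
  qed
qed

text \<open>
  Membership in \<open>{i, j}\<close> and membership in \<open>{k, l}\<close> change at the same steps from \<open>m\<close> to \<open>m + 1\<close>,
  so they agree everywhere on \<open>1, \<dots>, n\<close> or nowhere; the latter would cover \<open>n \<ge> 5\<close> points by two
  pairs.
\<close>

lemma band_pair_unique:
  assumes n: "5 \<le> n" and ij: "1 \<le> i" "i < j" "j \<le> n" and kl: "1 \<le> k" "k < l" "l \<le> n"
    and eq: "band i j = band k l"
  shows "i = k \<and> j = l"
proof -
  define agree where "agree m \<longleftrightarrow> (m \<in> {i, j} \<longleftrightarrow> m \<in> {k, l})" for m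
  have step: "agree (m + 1) \<longleftrightarrow> agree m" if "m \<in> {1..<n}" for m
    using band_moved_iff[OF ij that] band_moved_iff[OF kl that] eq unfolding agree_def by metis
  have const: "agree m \<longleftrightarrow> agree 1" if "1 \<le> m" "m \<le> n" for m
    using that by (induction m rule: dec_induct) (auto simp: step[simplified])
  have "agree 1"
  proof (rule ccontr)
    assume "\<not> agree 1"
    then have "m \<in> {i, j, k, l}" if "m \<in> {1..n}" for m
      using const[of m] that unfolding agree_def by auto
    then have "{1..n} \<subseteq> {i, j, k, l}" by blast
    then have "card {1..n} \<le> card {i, j, k, l}" by (rule card_mono[rotated]) simp
    also have "\<dots> \<le> 4" by (simp add: card_insert_if)
    finally show False using n by simp
  qed
  then have "{i, j} = {k, l}"
    using const[of i] const[of j] const[of k] const[of l] ij kl by (auto simp: agree_def)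
  then show ?thesis using ij(2) kl(2) by (auto simp: doubleton_eq_iff)
qed

lemma card_pairs_le_card_carrier:
  assumes "5 \<le> n" "finite (carrier Q)"
  shows "n choose 2 \<le> card (carrier Q)"
proof -
  let ?P = "{B. B \<subseteq> {1..n} \<and> card B = 2}"
  let ?b = "\<lambda>B. band (Min B) (Max B)"
  have ends: "B = {Min B, Max B}" "1 \<le> Min B" "Min B < Max B" "Max B \<le> n" if "B \<in> ?P" for B
    using two_subset_Min_Max[of B] that by force+
  have "inj_on ?b ?P"
  proof (rule inj_onI)
    fix B C assume B: "B \<in> ?P" and C: "C \<in> ?P" and "?b B = ?b C"
    then have "Min B = Min C \<and> Max B = Max C"
      using band_pair_unique[OF assms(1)] ends by metis
    then show "B = C" using ends(1)[OF B] ends(1)[OF C] by metis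
  qed
  moreover have "?b ` ?P \<subseteq> carrier Q"
    using ends by (auto intro!: band_closed)
  ultimately have "card ?P \<le> card (carrier Q)"
    using card_inj_on_le assms(2) by blast
  then show ?thesis by (simp add: n_subsets)
qed

end

section \<open>Dehn quandles\<close>

lemma (in group) dehn_quandle_carrier_subset:
  "A \<subseteq> carrier G \<Longrightarrow> carrier (dehn_quandle G A) \<subseteq> carrier G"
  by (auto simp: dehn_quandle_def)

lemma (in group) generator_in_dehn_quandle:
  assumes "A \<subseteq> carrier G" "a \<in> A"
  shows "a \<in> carrier (dehn_quandle G A)"
proof -
  have "a = \<one> \<otimes> a \<otimes> inv \<one>" using assms by auto
  then show ?thesis using assms(2) unfolding dehn_quandle_def by (simp del: inv_one) blast
qed

lemma (in group) dehn_quandle_conj_closed: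
  assumes A: "A \<subseteq> carrier G" and x: "x \<in> carrier (dehn_quandle G A)" and g: "g \<in> carrier G"
  shows "g \<otimes> x \<otimes> inv g \<in> carrier (dehn_quandle G A)"
proof -
  obtain h a where ha: "h \<in> carrier G" "a \<in> A" "x = h \<otimes> a \<otimes> inv h"
    using x by (auto simp: dehn_quandle_def)
  then have "g \<otimes> x \<otimes> inv g = (g \<otimes> h) \<otimes> a \<otimes> inv (g \<otimes> h)"
    using g A by (auto simp: m_assoc inv_mult_group subset_eq)
  then show ?thesis using ha g by (auto simp: dehn_quandle_def)
qed

lemma (in group) conj_inv_conj:
  assumes "a \<in> carrier G" "x \<in> carrier G"
  shows "a \<otimes> (inv a \<otimes> x \<otimes> a) \<otimes> inv a = x"
proof -
  have "a \<otimes> (inv a \<otimes> x \<otimes> a) \<otimes> inv a = a \<otimes> (inv a \<otimes> x)"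
    using assms by (simp add: m_assoc)
  also have "\<dots> = x" using assms by (simp flip: m_assoc)
  finally show ?thesis .
qed

lemma (in group) dehn_op_eq_iff:
  assumes "a \<in> carrier G" "b \<in> carrier G" "c \<in> carrier G"
  shows "b \<otimes> a \<otimes> inv b = c \<longleftrightarrow> b \<otimes> a = c \<otimes> b"
  using assms by (metis inv_solve_right m_closed)

lemma (in group) conj_conj_if_braid:
  assumes "a \<in> carrier G" "b \<in> carrier G" "a \<otimes> b \<otimes> a = b \<otimes> a \<otimes> b"
  shows "a \<otimes> (b \<otimes> a \<otimes> inv b) \<otimes> inv a = b"
proof -
  have "a \<otimes> (b \<otimes> a \<otimes> inv b) = (a \<otimes> b \<otimes> a) \<otimes> inv b"
    using assms(1,2) by (simp add: m_assoc)
  also have "\<dots> = b \<otimes> a" using assms by (simp add: m_assoc)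
  finally show ?thesis using assms(1,2) by (simp add: m_assoc)
qed

text \<open>
  Under \<open>f\<close>, conjugation by an element of \<open>A\<close> becomes the translation by \<open>c\<close>. That translation is
  injective and fixes \<open>c\<close>, so the fibre over \<open>c\<close> is closed under conjugation by the elements of \<open>A\<close>
  and by their inverses, hence by the whole group.
\<close>

lemma quandle_hom_const_if_const_on_generators:
  assumes Q: "quandle Q" and G: "group G" and A: "A \<subseteq> carrier G"
    and gen: "carrier G = generate G A"
    and f: "f \<in> quandle_hom (dehn_quandle G A) Q"
    and c: "\<And>a. a \<in> A \<Longrightarrow> f a = c"
    and x: "x \<in> carrier (dehn_quandle G A)"
  shows "f x = c"
proof -
  interpret Q: quandle Q by (fact Q)
  interpret G: group G by (fact G)
  let ?D = "dehn_quandle G A"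
  have op: "x \<star>\<^bsub>?D\<^esub> y = y \<otimes>\<^bsub>G\<^esub> x \<otimes>\<^bsub>G\<^esub> inv\<^bsub>G\<^esub> y" for x y by (simp add: dehn_quandle_def)
  note car = subsetD[OF G.dehn_quandle_carrier_subset[OF A]]
  note A_D = G.generator_in_dehn_quandle[OF A]
  note conj = G.dehn_quandle_conj_closed[OF A]
  have hom: "f (x \<star>\<^bsub>?D\<^esub> y) = f x \<star>\<^bsub>Q\<^esub> f y" if "x \<in> carrier ?D" "y \<in> carrier ?D" for x y
    using f that by (simp add: quandle_hom_def)
  have "\<forall>x\<in>carrier ?D. f x = c \<longrightarrow> f (g \<otimes>\<^bsub>G\<^esub> x \<otimes>\<^bsub>G\<^esub> inv\<^bsub>G\<^esub> g) = c" if "g \<in> generate G A" for g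
    using that
  proof (induction rule: generate.induct)
    case one
    then show ?case by (simp add: car)
  next
    case (incl a)
    have "f a \<in> carrier Q" using f A_D[OF incl] by (auto simp: quandle_hom_def)
    then show ?case
      using incl hom[OF _ A_D[OF incl]] c[OF incl] Q.idem by (auto simp: op)
  next
    case (inv a)
    have a: "a \<in> carrier G" and c_Q: "c \<in> carrier Q"
      using inv A f A_D[OF inv] c[OF inv] by (auto simp: quandle_hom_def)
    show ?case
    proof (intro ballI impI)
      fix x assume x: "x \<in> carrier ?D" "f x = c"
      define y where "y = inv\<^bsub>G\<^esub> a \<otimes>\<^bsub>G\<^esub> x \<otimes>\<^bsub>G\<^esub> a"
      have y: "y \<in> carrier ?D" using conj[OF x(1), of "inv\<^bsub>G\<^esub> a"] a by (simp add: y_def)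
      have "y \<star>\<^bsub>?D\<^esub> a = x" using G.conj_inv_conj[OF a car[OF x(1)]] by (simp add: op y_def)
      then have "f y \<star>\<^bsub>Q\<^esub> c = c" using hom[OF y A_D[OF inv]] c[OF inv] x(2) by simp
      moreover have "f y \<in> carrier Q" using f y by (auto simp: quandle_hom_def)
      ultimately have "f y = c" using Q.ex1_left[OF c_Q c_Q] Q.idem[OF c_Q] c_Q by metis
      then show "f (inv\<^bsub>G\<^esub> a \<otimes>\<^bsub>G\<^esub> x \<otimes>\<^bsub>G\<^esub> inv\<^bsub>G\<^esub> (inv\<^bsub>G\<^esub> a)) = c" using a by (simp add: y_def)
    qed
  next
    case (eng g h)
    have gh: "g \<in> carrier G" "h \<in> carrier G" using eng gen by auto
    have "(g \<otimes>\<^bsub>G\<^esub> h) \<otimes>\<^bsub>G\<^esub> x \<otimes>\<^bsub>G\<^esub> inv\<^bsub>G\<^esub> (g \<otimes>\<^bsub>G\<^esub> h) = g \<otimes>\<^bsub>G\<^esub> (h \<otimes>\<^bsub>G\<^esub> x \<otimes>\<^bsub>G\<^esub> inv\<^bsub>G\<^esub> h) \<otimes>\<^bsub>G\<^esub> inv\<^bsub>G\<^esub> g"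
      if "x \<in> carrier G" for x
      using that gh by (simp add: G.m_assoc G.inv_mult_group)
    then show ?case using eng gh conj car by simp
  qed
  moreover obtain g a where "g \<in> carrier G" "a \<in> A" "x = g \<otimes>\<^bsub>G\<^esub> a \<otimes>\<^bsub>G\<^esub> inv\<^bsub>G\<^esub> g"
    using x by (auto simp: dehn_quandle_def)
  ultimately show ?thesis using gen A_D c by auto
qed

section \<open>Quotients of the Dehn quandle of a braid group\<close>

lemma presented_group_generated:
  "carrier (presented_group X R) =
    generate (presented_group X R) ((\<lambda>x. pres_class X R [(True, x)]) ` X)"
proof -
  let ?G = "presented_group X R" and ?gen = "\<lambda>x. pres_class X R [(True, x)]"
  interpret group ?G by (rule group_presented_group)
  have one: "\<one>\<^bsub>?G\<^esub> = pres_class X R []" by (simp add: presented_group_def)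
  have w1: "[(b, x)] \<in> gwords X" if "x \<in> X" for b x using that by (simp add: gwords_def)
  have gens: "?gen ` X \<subseteq> carrier ?G" using w1 by (auto simp: carrier_presented_group)
  have letter: "pres_class X R [(b, x)] \<in> generate ?G (?gen ` X)" if x: "x \<in> X" for b x
  proof (cases b)
    case True
    then show ?thesis using x by (auto intro: generate.incl)
  next
    case False
    have "pres_class X R [(False, x)] \<otimes>\<^bsub>?G\<^esub> ?gen x = pres_class X R []"
      using x w1 pres_cong.cancel[of x X False R]
      by (simp add: mult_pres_class pres_class_eq_iff gwords_def)
    then have "pres_class X R [(False, x)] = inv\<^bsub>?G\<^esub> ?gen x"
      using x w1 by (intro inv_equality[symmetric])
        (auto simp: carrier_presented_group one)
    then show ?thesis using False x by (auto intro: generate.inv)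
  qed
  have "pres_class X R w \<in> generate ?G (?gen ` X)" if "w \<in> gwords X" for w
    using that
  proof (induction w)
    case Nil
    then show ?case using generate.one[of ?G] by (simp add: one)
  next
    case (Cons a w)
    obtain b x where a: "a = (b, x)" by (cases a)
    have w: "w \<in> gwords X" and x: "x \<in> X" using Cons.prems a by (auto simp: gwords_def)
    have "pres_class X R (a # w) = pres_class X R [(b, x)] \<otimes>\<^bsub>?G\<^esub> pres_class X R w"
      using w w1[OF x] a by (simp add: mult_pres_class)
    then show ?case using generate.eng[OF letter[OF x] Cons.IH[OF w]] by metis
  qed
  then show ?thesis
    using generate_in_carrier[OF gens] by (auto simp: carrier_presented_group)
qed

lemma braid_gen_commute:
  assumes "i \<in> {1..<n}" "j \<in> {1..<n}" "i + 1 < j \<or> j + 1 < i"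
  shows "braid_gen n i \<otimes>\<^bsub>braid_group n\<^esub> braid_gen n j = braid_gen n j \<otimes>\<^bsub>braid_group n\<^esub> braid_gen n i"
proof -
  have "([(True, i), (True, j)], [(True, j), (True, i)]) \<in> braid_relations n"
    using assms by (auto simp: braid_relations_def)
  then show ?thesis
    using assms unfolding braid_gen_def braid_group_def
    by (simp add: mult_pres_class pres_class_eq_iff gwords_def pres_cong.rel)
qed

lemma braid_gen_braid:
  assumes "i \<in> {1..<n}" "j \<in> {1..<n}" "j = i + 1 \<or> i = j + 1"
  shows "braid_gen n i \<otimes>\<^bsub>braid_group n\<^esub> braid_gen n j \<otimes>\<^bsub>braid_group n\<^esub> braid_gen n i =
    braid_gen n j \<otimes>\<^bsub>braid_group n\<^esub> braid_gen n i \<otimes>\<^bsub>braid_group n\<^esub> braid_gen n j"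
proof -
  have up: "braid_gen n i \<otimes>\<^bsub>braid_group n\<^esub> braid_gen n (i + 1) \<otimes>\<^bsub>braid_group n\<^esub> braid_gen n i =
      braid_gen n (i + 1) \<otimes>\<^bsub>braid_group n\<^esub> braid_gen n i \<otimes>\<^bsub>braid_group n\<^esub> braid_gen n (i + 1)"
    if "1 \<le> i" "i + 1 < n" for i
  proof -
    have "([(True, i), (True, i + 1), (True, i)], [(True, i + 1), (True, i), (True, i + 1)])
        \<in> braid_relations n"
      using that by (auto simp: braid_relations_def)
    then show ?thesis
      using that unfolding braid_gen_def braid_group_def
      by (simp add: mult_pres_class pres_class_eq_iff gwords_def pres_cong.rel)
  qed
  show ?thesis
  proof (cases "j = i + 1")
    case True
    then show ?thesis using up[of i] assms(1,2) by simp
  next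
    case False
    then have "i = j + 1" using assms(3) by simp
    then show ?thesis using up[of j] assms(1,2) by simp
  qed
qed

lemma braided_quandle_of_hom:
  assumes Q: "quandle Q" and f: "f \<in> quandle_hom (dehn_quandle (braid_group n) (braid_gens n)) Q"
  shows "braided_quandle Q n (f \<circ> braid_gen n)"
proof -
  interpret Q: quandle Q by (fact Q)
  let ?B = "braid_group n" and ?s = "braid_gen n"
  let ?D = "dehn_quandle ?B (braid_gens n)"
  interpret B: group ?B by (rule group_braid_group)
  have s: "?s i \<in> carrier ?B" if "i \<in> {1..<n}" for i
    using that braid_gens_subset[of n] by (auto simp: braid_gens_def)
  have s_D: "?s i \<in> carrier ?D" if "i \<in> {1..<n}" for i
    using that by (intro B.generator_in_dehn_quandle braid_gens_subset) (simp add: braid_gens_def)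
  have op: "x \<star>\<^bsub>?D\<^esub> y = y \<otimes>\<^bsub>?B\<^esub> x \<otimes>\<^bsub>?B\<^esub> inv\<^bsub>?B\<^esub> y" for x y by (simp add: dehn_quandle_def)
  have hom: "f x \<star>\<^bsub>Q\<^esub> f y = f (x \<star>\<^bsub>?D\<^esub> y)" if "x \<in> carrier ?D" "y \<in> carrier ?D" for x y
    using f that by (simp add: quandle_hom_def)
  show ?thesis
  proof
    fix i assume "i \<in> {1..<n}"
    then show "(f \<circ> ?s) i \<in> carrier Q" using f s_D by (auto simp: quandle_hom_def)
  next
    fix i j assume ij: "i \<in> {1..<n}" "j \<in> {1..<n}" "i + 1 < j \<or> j + 1 < i"
    have "?s i \<star>\<^bsub>?D\<^esub> ?s j = ?s i"
      using braid_gen_commute[OF ij] s ij by (simp add: op B.dehn_op_eq_iff)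
    then show "(f \<circ> ?s) i \<star>\<^bsub>Q\<^esub> (f \<circ> ?s) j = (f \<circ> ?s) i" using ij s_D by (simp add: hom)
  next
    fix i j assume ij: "i \<in> {1..<n}" "j \<in> {1..<n}" "j = i + 1 \<or> i = j + 1"
    have ij_D: "?s i \<star>\<^bsub>?D\<^esub> ?s j \<in> carrier ?D"
      using B.dehn_quandle_conj_closed[OF braid_gens_subset s_D s] ij by (simp add: op)
    have "(?s i \<star>\<^bsub>?D\<^esub> ?s j) \<star>\<^bsub>?D\<^esub> ?s i = ?s j"
      using B.conj_conj_if_braid[OF s s braid_gen_braid[OF ij]] ij by (simp add: op)
    then show "((f \<circ> ?s) i \<star>\<^bsub>Q\<^esub> (f \<circ> ?s) j) \<star>\<^bsub>Q\<^esub> (f \<circ> ?s) i = (f \<circ> ?s) j"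
      using ij s_D ij_D by (simp add: hom)
  qed
qed

lemma card_quotient_of_braid_dehn_quandle:
  assumes n: "5 \<le> n" and Q: "quandle Q" and nontrivial: "x \<in> carrier Q" "y \<in> carrier Q" "x \<noteq> y"
    and f: "f \<in> quandle_epi (dehn_quandle (braid_group n) (braid_gens n)) Q"
    and fin: "finite (carrier Q)"
  shows "n choose 2 \<le> card (carrier Q)"
proof -
  let ?D = "dehn_quandle (braid_group n) (braid_gens n)"
  have hom: "f \<in> quandle_hom ?D Q" and onto: "f ` carrier ?D = carrier Q"
    using f by (auto simp: quandle_epi_def)
  interpret braided_quandle Q n "f \<circ> braid_gen n" by (rule braided_quandle_of_hom[OF Q hom])
  have "\<exists>i\<in>{1..<n}. \<exists>j\<in>{1..<n}. (f \<circ> braid_gen n) i \<noteq> (f \<circ> braid_gen n) j"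
  proof (rule ccontr)
    assume const: "\<not> ?thesis"
    have "f (braid_gen n i) = f (braid_gen n 1)" if "i \<in> {1..<n}" for i
    proof -
      have "1 \<in> {1..<n}" using n by simp
      then show ?thesis using const that unfolding comp_def by blast
    qed
    then have gens: "f a = f (braid_gen n 1)" if "a \<in> braid_gens n" for a
      using that unfolding braid_gens_def by blast
    have gen: "carrier (braid_group n) = generate (braid_group n) (braid_gens n)"
      unfolding braid_group_def braid_gens_def braid_gen_def by (rule presented_group_generated)
    have "f z = f (braid_gen n 1)" if "z \<in> carrier ?D" for z
      by (rule quandle_hom_const_if_const_on_generators
          [OF Q group_braid_group braid_gens_subset gen hom gens that])
    moreover obtain u v where "u \<in> carrier ?D" "f u = x" "v \<in> carrier ?D" "f v = y"
      using nontrivial(1,2) unfolding onto[symmetric] by blast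
    ultimately show False using nontrivial by metis
  qed
  then interpret nonconstant_braided_quandle Q n "f \<circ> braid_gen n" by unfold_locales
  show ?thesis by (rule card_pairs_le_card_carrier[OF n fin])
qed

section \<open>Images of quandles\<close>

lemma quandle_epi_compose:
  assumes "f \<in> quandle_epi P Q" "g \<in> quandle_epi Q R"
  shows "g \<circ> f \<in> quandle_epi P R"
proof -
  have "(g \<circ> f) ` carrier P = g ` f ` carrier P" by (rule image_comp[symmetric])
  then have "(g \<circ> f) ` carrier P = carrier R"
    using assms by (simp add: quandle_epi_def)
  moreover have "g \<circ> f \<in> quandle_hom P R"
    using assms by (simp add: quandle_epi_def quandle_hom_def Pi_iff)
  ultimately show ?thesis by (simp add: quandle_epi_def)
qed

text \<open>
  A finite quandle of permutations becomes in this way a quandle of natural numbers.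
\<close>

lemma quandle_transport:
  assumes Q: "quandle Q" and e: "inj_on e (carrier Q)"
  obtains R :: "'b quandle_struct"
  where "quandle R" "carrier R = e ` carrier Q" "e \<in> quandle_epi Q R"
proof -
  interpret Q: quandle Q by (fact Q)
  define d where "d = the_inv_into (carrier Q) e"
  define R :: "'b quandle_struct"
    where "R = \<lparr>carrier = e ` carrier Q, qop = (\<lambda>x y. e (d x \<star>\<^bsub>Q\<^esub> d y))\<rparr>"
  have car: "carrier R = e ` carrier Q" by (simp add: R_def)
  have d: "d (e x) = x" if "x \<in> carrier Q" for x
    using e that by (simp add: d_def the_inv_into_f_f)
  have op: "e x \<star>\<^bsub>R\<^esub> e y = e (x \<star>\<^bsub>Q\<^esub> y)" if "x \<in> carrier Q" "y \<in> carrier Q" for x y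
    using that by (simp add: R_def d)
  have eq_iff: "e x = e y \<longleftrightarrow> x = y" if "x \<in> carrier Q" "y \<in> carrier Q" for x y
    using e that by (simp add: inj_on_eq_iff)
  have "quandle R"
  proof
    show "carrier R \<noteq> {}" using Q.nonempty by (simp add: car)
  next
    fix x y assume "x \<in> carrier R" "y \<in> carrier R"
    then show "x \<star>\<^bsub>R\<^esub> y \<in> carrier R" by (auto simp: car op Q.closed)
  next
    fix x assume "x \<in> carrier R"
    then show "x \<star>\<^bsub>R\<^esub> x = x" by (auto simp: car op Q.idem)
  next
    fix x y assume "x \<in> carrier R" "y \<in> carrier R"
    then obtain u v where u: "u \<in> carrier Q" "x = e u" and v: "v \<in> carrier Q" "y = e v"
      by (auto simp: car)
    then obtain w where w: "w \<in> carrier Q" "u = w \<star>\<^bsub>Q\<^esub> v"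
      and uniq: "\<And>z. \<lbrakk>z \<in> carrier Q; u = z \<star>\<^bsub>Q\<^esub> v\<rbrakk> \<Longrightarrow> z = w"
      using Q.ex1_left[of u v] by metis
    show "\<exists>!z. z \<in> carrier R \<and> x = z \<star>\<^bsub>R\<^esub> y"
    proof (rule ex1I[of _ "e w"])
      show "e w \<in> carrier R \<and> x = e w \<star>\<^bsub>R\<^esub> y" using u v w by (simp add: car op)
    next
      fix z assume z: "z \<in> carrier R \<and> x = z \<star>\<^bsub>R\<^esub> y"
      then obtain t where t: "t \<in> carrier Q" "z = e t" by (auto simp: car)
      then have "e u = e (t \<star>\<^bsub>Q\<^esub> v)" using z u v by (simp add: op)
      then have "u = t \<star>\<^bsub>Q\<^esub> v" using eq_iff[OF u(1) Q.closed[OF t(1) v(1)]] by simp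
      then show "z = e w" using uniq[OF t(1)] t(2) by simp
    qed
  next
    fix x y z assume "x \<in> carrier R" "y \<in> carrier R" "z \<in> carrier R"
    then obtain u v w where "u \<in> carrier Q" "x = e u" "v \<in> carrier Q" "y = e v"
      "w \<in> carrier Q" "z = e w"
      by (auto simp: car)
    then show "(x \<star>\<^bsub>R\<^esub> y) \<star>\<^bsub>R\<^esub> z = (x \<star>\<^bsub>R\<^esub> z) \<star>\<^bsub>R\<^esub> (y \<star>\<^bsub>R\<^esub> z)"
      using Q.distrib[of u v w] by (simp add: op Q.closed)
  qed
  moreover have "e \<in> quandle_epi Q R"
    by (auto simp: quandle_epi_def quandle_hom_def car op)
  ultimately show ?thesis using that car by blast
qed

text \<open>
  The image of a Dehn quandle is again a Dehn quandle, of the image subgroup. Using that subgroup,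
  and not all of \<open>H\<close>, gives surjectivity for any homomorphism \<open>h\<close>.
\<close>

lemma (in group_hom) quandle_epi_dehn_image:
  assumes A: "A \<subseteq> carrier G" "A \<noteq> {}"
  defines "I \<equiv> H\<lparr>carrier := h ` carrier G\<rparr>"
  shows "quandle (dehn_quandle I (h ` A))"
    and "h \<in> quandle_epi (dehn_quandle G A) (dehn_quandle I (h ` A))"
proof -
  have sub: "subgroup (h ` carrier G) H" by (rule img_is_subgroup)
  interpret I: group I unfolding I_def by (rule H.subgroup_imp_group[OF sub])
  show "quandle (dehn_quandle I (h ` A))"
    using A by (intro I.quandle_dehn_quandle) (auto simp: I_def)
  have inv: "inv\<^bsub>I\<^esub> (h g) = inv\<^bsub>H\<^esub> (h g)" if "g \<in> carrier G" for g
    unfolding I_def using that by (intro H.m_inv_consistent[OF sub]) simp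
  have conj: "h (g \<otimes> a \<otimes> inv g) = h g \<otimes>\<^bsub>I\<^esub> h a \<otimes>\<^bsub>I\<^esub> inv\<^bsub>I\<^esub> (h g)"
    if "g \<in> carrier G" "a \<in> carrier G" for g a
    using that inv[OF that(1)] by (simp add: I_def)
  have "h ` carrier (dehn_quandle G A) = carrier (dehn_quandle I (h ` A))"
  proof (intro equalityI subsetI)
    fix y assume "y \<in> h ` carrier (dehn_quandle G A)"
    then obtain g a where "g \<in> carrier G" "a \<in> A" "y = h (g \<otimes> a \<otimes> inv g)"
      by (auto simp: dehn_quandle_def)
    then have "y = h g \<otimes>\<^bsub>I\<^esub> h a \<otimes>\<^bsub>I\<^esub> inv\<^bsub>I\<^esub> (h g)" "h g \<in> carrier I" "h a \<in> h ` A"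
      using conj A(1) by (auto simp: I_def)
    then show "y \<in> carrier (dehn_quandle I (h ` A))"
      unfolding dehn_quandle_def by auto
  next
    fix y assume "y \<in> carrier (dehn_quandle I (h ` A))"
    then obtain g a where ga: "g \<in> carrier G" "a \<in> A" "y = h g \<otimes>\<^bsub>I\<^esub> h a \<otimes>\<^bsub>I\<^esub> inv\<^bsub>I\<^esub> (h g)"
      unfolding dehn_quandle_def by (auto simp: I_def)
    then have "y = h (g \<otimes> a \<otimes> inv g)" using conj A(1) by auto
    then show "y \<in> h ` carrier (dehn_quandle G A)"
      using ga unfolding dehn_quandle_def by auto
  qed
  moreover have "h (x \<star>\<^bsub>dehn_quandle G A\<^esub> y) = h x \<star>\<^bsub>dehn_quandle I (h ` A)\<^esub> h y"
    if "x \<in> carrier (dehn_quandle G A)" "y \<in> carrier (dehn_quandle G A)" for x y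
  proof -
    have "x \<in> carrier G" "y \<in> carrier G"
      using that G.dehn_quandle_carrier_subset[OF A(1)] by auto
    then show ?thesis using conj[of y x] by (simp add: dehn_quandle_def)
  qed
  ultimately show "h \<in> quandle_epi (dehn_quandle G A) (dehn_quandle I (h ` A))"
    by (auto simp: quandle_epi_def quandle_hom_def)
qed

section \<open>The permutation representation of the braid group\<close>

primrec word_value :: "('b, 'm) monoid_scheme \<Rightarrow> ('a \<Rightarrow> 'b) \<Rightarrow> 'a gword \<Rightarrow> 'b" where
  "word_value H g [] = \<one>\<^bsub>H\<^esub>"
| "word_value H g (a # w) =
    (if fst a then g (snd a) else inv\<^bsub>H\<^esub> g (snd a)) \<otimes>\<^bsub>H\<^esub> word_value H g w"

lemma (in group) word_value_closed:
  assumes "g \<in> X \<rightarrow> carrier G" "w \<in> gwords X"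
  shows "word_value G g w \<in> carrier G"
  using assms(2)
proof (induction w)
  case Nil
  then show ?case by simp
next
  case (Cons a w)
  then have "w \<in> gwords X" "g (snd a) \<in> carrier G"
    using assms(1) by (auto simp: gwords_def)
  then show ?case using Cons.IH by simp
qed

lemma (in group) word_value_append:
  assumes g: "g \<in> X \<rightarrow> carrier G" and "u \<in> gwords X" and v: "v \<in> gwords X"
  shows "word_value G g (u @ v) = word_value G g u \<otimes> word_value G g v"
  using assms(2)
proof (induction u)
  case Nil
  then show ?case using word_value_closed[OF g v] by simp
next
  case (Cons a u)
  then have "u \<in> gwords X" "g (snd a) \<in> carrier G"
    using g by (auto simp: gwords_def)
  then show ?case
    using Cons.IH word_value_closed[OF g v] word_value_closed[OF g, of u] by (simp add: m_assoc)
qed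

lemma (in group) word_value_cong:
  assumes g: "g \<in> X \<rightarrow> carrier G"
    and R: "\<And>u v. (u, v) \<in> R \<Longrightarrow> word_value G g u = word_value G g v"
    and uv: "(u, v) \<in> pres_cong X R"
  shows "word_value G g u = word_value G g v"
  using uv
proof (induction rule: pres_cong.induct)
  case (rel u v)
  then show ?case using R by simp
next
  case (cancel x b)
  then have "g x \<in> carrier G" using g by auto
  then show ?case by simp
next
  case (append u v u' v')
  then show ?case
    using pres_cong_gwords[OF append.hyps(1)] pres_cong_gwords[OF append.hyps(2)]
    by (simp add: word_value_append[OF g])
qed simp_all

text \<open>The universal property of a presentation; the homomorphism evaluates words.\<close>

lemma (in group) presented_group_hom_extends:
  assumes g: "g \<in> X \<rightarrow> carrier G"
    and R: "\<And>u v. (u, v) \<in> R \<Longrightarrow> word_value G g u = word_value G g v"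
  shows "\<exists>h\<in>hom (presented_group X R) G. \<forall>x\<in>X. h (pres_class X R [(True, x)]) = g x"
proof -
  define h where "h C = the_elem (word_value G g ` C)" for C
  have h: "h (pres_class X R w) = word_value G g w" if w: "w \<in> gwords X" for w
  proof -
    have "word_value G g u = word_value G g w" if "u \<in> pres_class X R w" for u
    proof -
      have uw: "(u, w) \<in> pres_cong X R" using that by (simp add: pres_class_def pres_cong.sym)
      show ?thesis by (rule word_value_cong[OF g _ uw]) (rule R)
    qed
    moreover have "w \<in> pres_class X R w"
      using w by (simp add: pres_class_def pres_cong.refl)
    ultimately have "word_value G g ` pres_class X R w = {word_value G g w}" by blast
    then show ?thesis by (simp add: h_def)
  qed
  have "h \<in> hom (presented_group X R) G"
  proof (rule homI)
    fix C assume "C \<in> carrier (presented_group X R)"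
    then show "h C \<in> carrier G"
      using h word_value_closed[OF g] by (auto simp: carrier_presented_group)
  next
    fix C D assume "C \<in> carrier (presented_group X R)" "D \<in> carrier (presented_group X R)"
    then obtain u v where uv: "u \<in> gwords X" "v \<in> gwords X"
      "C = pres_class X R u" "D = pres_class X R v"
      by (auto simp: carrier_presented_group)
    moreover have "u @ v \<in> gwords X" using uv by (auto simp: gwords_def)
    ultimately show "h (C \<otimes>\<^bsub>presented_group X R\<^esub> D) = h C \<otimes> h D"
      by (simp add: mult_pres_class h word_value_append[OF g])
  qed
  moreover have "h (pres_class X R [(True, x)]) = g x" if "x \<in> X" for x
  proof -
    have "g x \<in> carrier G" using g that by auto
    then show ?thesis using h[of "[(True, x)]"] that by (simp add: gwords_def)
  qed
  ultimately show ?thesis by blast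
qed

lemma braid_group_to_sym_group:
  obtains h where "h \<in> hom (braid_group n) (sym_group n)"
    and "\<And>i. i \<in> {1..<n} \<Longrightarrow> h (braid_gen n i) = transpose i (i + 1)"
proof -
  interpret S: group "sym_group n" by (rule sym_group_is_group)
  let ?t = "\<lambda>i::nat. transpose i (i + 1)"
  have t: "?t \<in> {1..<n} \<rightarrow> carrier (sym_group n)"
    by (auto simp: sym_group_carrier intro!: permutes_swap_id)
  have braid: "?t i \<circ> (?t (i + 1) \<circ> ?t i) = ?t (i + 1) \<circ> (?t i \<circ> ?t (i + 1))" for i
    by (rule ext) (simp add: transpose_def)
  have commute: "?t i \<circ> ?t j = ?t j \<circ> ?t i" if "2 \<le> \<bar>int i - int j\<bar>" for i j
    using that by (intro ext) (auto simp: transpose_def)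
  have relations_hold: "word_value (sym_group n) ?t u = word_value (sym_group n) ?t v"
    if "(u, v) \<in> braid_relations n" for u v
    using that unfolding braid_relations_def
    by (auto simp: sym_group_mult sym_group_one simp del: One_nat_def add_Suc_right
        intro: braid commute)
  obtain h where h: "h \<in> hom (presented_group {1..<n} (braid_relations n)) (sym_group n)"
    and h_gen: "\<forall>i\<in>{1..<n}. h (pres_class {1..<n} (braid_relations n) [(True, i)]) = ?t i"
    using S.presented_group_hom_extends[OF t relations_hold] ..
  show ?thesis
    by (rule that[of h, unfolded braid_group_def braid_gen_def, OF h bspec[OF h_gen]])
qed

lemma conj_transpose:
  assumes p: "bij p" "p \<circ> r = id"
  shows "p \<circ> transpose a b \<circ> r = transpose (p a) (p b)"
proof -
  have "transpose (p a) (p b) \<circ> p = p \<circ> transpose a b"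
    using p(1) by (simp add: transpose_comp_eq bij_is_inj)
  then have "p \<circ> transpose a b \<circ> r = transpose (p a) (p b) \<circ> (p \<circ> r)"
    by (metis comp_assoc)
  then show ?thesis using p(2) by simp
qed

lemma image_of_braid_dehn_quandle_in_sym_group:
  assumes h: "h \<in> hom (braid_group n) (sym_group n)"
    and h_gen: "\<And>i. i \<in> {1..<n} \<Longrightarrow> h (braid_gen n i) = transpose i (i + 1)"
  shows "h ` carrier (dehn_quandle (braid_group n) (braid_gens n)) \<subseteq>
    (\<lambda>B. transpose (Min B) (Max B)) ` {B. B \<subseteq> {1..n} \<and> card B = 2}"
proof
  interpret h: group_hom "braid_group n" "sym_group n" h
    by (intro group_hom.intro group_hom_axioms.intro group_braid_group sym_group_is_group h)
  fix t assume "t \<in> h ` carrier (dehn_quandle (braid_group n) (braid_gens n))"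
  then obtain g i where g: "g \<in> carrier (braid_group n)" and i: "i \<in> {1..<n}"
    and "t = h (g \<otimes>\<^bsub>braid_group n\<^esub> braid_gen n i \<otimes>\<^bsub>braid_group n\<^esub> inv\<^bsub>braid_group n\<^esub> g)"
    by (auto simp: dehn_quandle_def braid_gens_def)
  moreover have "braid_gen n i \<in> carrier (braid_group n)"
    using i braid_gens_subset[of n] by (auto simp: braid_gens_def)
  ultimately have t: "t = h g \<circ> transpose i (i + 1) \<circ> inv\<^bsub>sym_group n\<^esub> (h g)"
    by (simp add: h_gen sym_group_mult)
  have p: "h g permutes {1..n}" using h.hom_closed[OF g] by (simp add: sym_group_carrier)
  have "h g \<circ> inv\<^bsub>sym_group n\<^esub> (h g) = id"
    using h.H.r_inv[OF h.hom_closed[OF g]] by (simp add: sym_group_mult sym_group_one)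
  then have t': "t = transpose (h g i) (h g (i + 1))"
    using t conj_transpose[OF permutes_bij[OF p]] by metis
  define B where "B = {h g i, h g (i + 1)}"
  have "h g i \<noteq> h g (i + 1)" using permutes_inj[OF p] by (simp add: inj_eq)
  then have B: "card B = 2" by (simp add: B_def)
  have "i \<in> {1..n}" "i + 1 \<in> {1..n}" using i by auto
  then have "h g i \<in> {1..n}" "h g (i + 1) \<in> {1..n}"
    by (simp_all only: permutes_in_image[OF p])
  then have "B \<subseteq> {1..n}" unfolding B_def by blast
  moreover have "t = transpose (Min B) (Max B)"
  proof -
    have "{h g i, h g (i + 1)} = {Min B, Max B}"
      using two_subset_Min_Max(1)[OF B] by (simp only: B_def)
    then show ?thesis unfolding t' doubleton_eq_iff by (metis transpose_commute)
  qed
  ultimately show "t \<in> (\<lambda>B. transpose (Min B) (Max B)) ` {B. B \<subseteq> {1..n} \<and> card B = 2}"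
    using B by blast
qed

text \<open>
  The transpositions \<open>(1 2)\<close> and \<open>(2 3)\<close> in the image show that the quotient is nontrivial. The
  lower bound then supplies the second half of the cardinality, so there is no need to show that
  every transposition occurs.
\<close>

lemma nat_quandle_attaining_bound:
  assumes n: "5 \<le> n"
  obtains R :: "nat quandle_struct" and f x y
  where "quandle R" "x \<in> carrier R" "y \<in> carrier R" "x \<noteq> y"
    "f \<in> quandle_epi (dehn_quandle (braid_group n) (braid_gens n)) R"
    "finite (carrier R)" "card (carrier R) = n choose 2"
proof -
  let ?D = "dehn_quandle (braid_group n) (braid_gens n)"
  obtain h where h: "h \<in> hom (braid_group n) (sym_group n)"
    and h_gen: "\<And>i. i \<in> {1..<n} \<Longrightarrow> h (braid_gen n i) = transpose i (i + 1)"
    by (rule braid_group_to_sym_group[of n]) blast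
  interpret h: group_hom "braid_group n" "sym_group n" h
    by (intro group_hom.intro group_hom_axioms.intro group_braid_group sym_group_is_group h)
  have gens_ne: "braid_gens n \<noteq> {}" using n by (simp add: braid_gens_def)
  obtain Q :: "(nat \<Rightarrow> nat) quandle_struct" where Q: "quandle Q" "h \<in> quandle_epi ?D Q"
    using h.quandle_epi_dehn_image[OF braid_gens_subset gens_ne] by blast
  have car: "carrier Q = h ` carrier ?D" using Q(2) by (simp add: quandle_epi_def)
  let ?P = "{B. B \<subseteq> {1..n} \<and> card B = 2}"
  have fin_P: "finite ?P" by simp
  have sub: "carrier Q \<subseteq> (\<lambda>B. transpose (Min B) (Max B)) ` ?P"
    unfolding car by (rule image_of_braid_dehn_quandle_in_sym_group[OF h h_gen])
  have fin: "finite (carrier Q)" using finite_subset[OF sub] fin_P by blast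
  have "card (carrier Q) \<le> card ?P" by (rule surj_card_le[OF fin_P sub])
  then have upper: "card (carrier Q) \<le> n choose 2" by (simp add: n_subsets)
  obtain e :: "(nat \<Rightarrow> nat) \<Rightarrow> nat" where e: "inj_on e (carrier Q)"
    using finite_imp_inj_to_nat_seg[OF fin] by blast
  obtain R :: "nat quandle_struct"
    where R: "quandle R" "carrier R = e ` carrier Q" "e \<in> quandle_epi Q R"
    by (rule quandle_transport[OF Q(1) e])
  have f: "e \<circ> h \<in> quandle_epi ?D R" by (rule quandle_epi_compose[OF Q(2) R(3)])
  have gen_Q: "transpose i (i + 1) \<in> carrier Q" if "i \<in> {1..<n}" for i
  proof -
    have "braid_gen n i \<in> carrier ?D"
      using that by (intro h.G.generator_in_dehn_quandle braid_gens_subset)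
        (simp add: braid_gens_def)
    then show ?thesis using h_gen[OF that] car by (metis imageI)
  qed
  have in_Q: "transpose 1 2 \<in> carrier Q" "transpose 2 3 \<in> carrier Q"
    using gen_Q[of 1] gen_Q[of 2] n by (simp_all add: numeral_eq_Suc)
  have "transpose 1 2 (1::nat) \<noteq> transpose 2 3 1" by (simp add: transpose_def)
  then have "transpose 1 2 \<noteq> transpose 2 (3::nat)" by metis
  then have neq: "e (transpose 1 2) \<noteq> e (transpose 2 3)"
    using in_Q e by (simp add: inj_on_eq_iff)
  have in_R: "e (transpose 1 2) \<in> carrier R" "e (transpose 2 3) \<in> carrier R"
    using in_Q R(2) by auto
  have fin_R: "finite (carrier R)" using fin R(2) by simp
  have "card (carrier R) \<le> n choose 2"
    using upper e R(2) by (simp add: card_image)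
  moreover have "n choose 2 \<le> card (carrier R)"
    by (rule card_quotient_of_braid_dehn_quandle[OF n R(1) in_R neq f fin_R])
  ultimately show ?thesis using that[OF R(1) in_R neq f fin_R] by simp
qed

theorem proposition4p5:
  fixes n :: nat
  assumes "5 \<le> n"
  shows "(\<forall>(Q :: 'b quandle_struct) f.
            quandle Q \<and> (\<exists>x\<in>carrier Q. \<exists>y\<in>carrier Q. x \<noteq> y) \<and>
            f \<in> quandle_epi (dehn_quandle (braid_group n) (braid_gens n)) Q
            \<longrightarrow> infinite (carrier Q) \<or> n * (n - 1) div 2 \<le> card (carrier Q))
       \<and> (\<exists>(Q :: nat quandle_struct) f.
            quandle Q \<and> (\<exists>x\<in>carrier Q. \<exists>y\<in>carrier Q. x \<noteq> y) \<and>
            f \<in> quandle_epi (dehn_quandle (braid_group n) (braid_gens n)) Q \<and>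
            finite (carrier Q) \<and> card (carrier Q) = n * (n - 1) div 2)"
proof (intro conjI allI impI)
  fix Q :: "'b quandle_struct" and f
  assume "quandle Q \<and> (\<exists>x\<in>carrier Q. \<exists>y\<in>carrier Q. x \<noteq> y) \<and>
    f \<in> quandle_epi (dehn_quandle (braid_group n) (braid_gens n)) Q"
  then show "infinite (carrier Q) \<or> n * (n - 1) div 2 \<le> card (carrier Q)"
    using card_quotient_of_braid_dehn_quandle[OF assms, of Q] unfolding choose_two by blast
next
  show "\<exists>(Q :: nat quandle_struct) f.
      quandle Q \<and> (\<exists>x\<in>carrier Q. \<exists>y\<in>carrier Q. x \<noteq> y) \<and>
      f \<in> quandle_epi (dehn_quandle (braid_group n) (braid_gens n)) Q \<and>
      finite (carrier Q) \<and> card (carrier Q) = n * (n - 1) div 2"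
    using nat_quandle_attaining_bound[OF assms] unfolding choose_two by metis
qed

end
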